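(* Let $Q=(Q,\cdot)$ be a quasigroup with parastrophes $Q_1,\dots,Q_5$. Then $Q$ has exactly three classes of isotopic parastrophes if and only if one of the following holds: (1) $Q\not\sim Q$, $Q\sim Q_3$ and $Q\not\sim Q_i$ for $i=1,2,4$; (2) $Q\not\sim Q$, $Q\sim Q_4$ and $Q\not\sim Q_i$ for $i=1,2,3$; (3) $Q\sim Q$, $Q\sim Q_5$ and $Q\not\sim Q_i$ for $i=1,2,3,4$. In case (1) the classes are $\{Q,Q_2\}$, $\{Q_1,Q_4\}$ and $\{Q_3,Q_5\}$; in case (2) they are $\{Q,Q_1\}$, $\{Q_2,Q_3\}$ and $\{Q_4,Q_5\}$; in case (3) they are $\{Q,Q_5\}$, $\{Q_1,Q_3\}$ and $\{Q_2,Q_4\}$.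
   Context: $S_Q$ is the set of all permutations of the set $Q$. Quasigroups $(Q,\cdot)$ and $(Q,\circ)$ on the same set are isotopic, written $(Q,\cdot)\approx(Q,\circ)$, if there are $\alpha,\beta,\gamma\in S_Q$ with $\alpha(x)\circ\beta(y)=\gamma(x\cdot y)$ for all $x,y\in Q$. They are anti-isotopic, written $(Q,\cdot)\sim(Q,\circ)$, if there are $\alpha,\beta,\gamma\in S_Q$ with $\alpha(x)\circ\beta(y)=\gamma(y\cdot x)$ for all $x,y\in Q$. The parastrophes $Q_i=(Q,\circ_i)$, $i=1,\dots,5$, of a quasigroup $(Q,\cdot)$ are defined by: $x\circ_1 y=z\iff x\cdot z=y$; $x\circ_2 y=z\iff z\cdot y=x$; $x\circ_3 y=z\iff z\cdot x=y$; $x\circ_4 y=z\iff y\cdot z=x$; $x\circ_5 y=z\iff y\cdot x=z$. The classes of isotopic parastrophes of $Q$ are the equivalence classes of $\{Q,Q_1,Q_2,Q_3,Q_4,Q_5\}$ under the equivalence relation $\approx$. *)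

theory Defs
  imports Main
begin

definition quasigroup :: "'a set \<Rightarrow> ('a \<Rightarrow> 'a \<Rightarrow> 'a) \<Rightarrow> bool" where
  "quasigroup Q f \<longleftrightarrow>
     (\<forall>x\<in>Q. \<forall>y\<in>Q. f x y \<in> Q) \<and>
     (\<forall>a\<in>Q. \<forall>b\<in>Q. \<exists>!x. x \<in> Q \<and> f a x = b) \<and>
     (\<forall>a\<in>Q. \<forall>b\<in>Q. \<exists>!y. y \<in> Q \<and> f y a = b)"

definition isotopic :: "'a set \<Rightarrow> ('a \<Rightarrow> 'a \<Rightarrow> 'a) \<Rightarrow> ('a \<Rightarrow> 'a \<Rightarrow> 'a) \<Rightarrow> bool" where
  "isotopic Q f g \<longleftrightarrow>
     (\<exists>\<alpha> \<beta> \<gamma>. bij_betw \<alpha> Q Q \<and> bij_betw \<beta> Q Q \<and> bij_betw \<gamma> Q Q \<and>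
        (\<forall>x\<in>Q. \<forall>y\<in>Q. g (\<alpha> x) (\<beta> y) = \<gamma> (f x y)))"

definition anti_isotopic :: "'a set \<Rightarrow> ('a \<Rightarrow> 'a \<Rightarrow> 'a) \<Rightarrow> ('a \<Rightarrow> 'a \<Rightarrow> 'a) \<Rightarrow> bool" where
  "anti_isotopic Q f g \<longleftrightarrow>
     (\<exists>\<alpha> \<beta> \<gamma>. bij_betw \<alpha> Q Q \<and> bij_betw \<beta> Q Q \<and> bij_betw \<gamma> Q Q \<and>
        (\<forall>x\<in>Q. \<forall>y\<in>Q. g (\<alpha> x) (\<beta> y) = \<gamma> (f y x)))"

(* Index 0 is the quasigroup itself; only the indices 0,...,5 are meaningful. *)
definition parastrophe :: "'a set \<Rightarrow> ('a \<Rightarrow> 'a \<Rightarrow> 'a) \<Rightarrow> nat \<Rightarrow> 'a \<Rightarrow> 'a \<Rightarrow> 'a" where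
  "parastrophe Q f i =
     (if i = 0 then f
      else if i = 1 then (\<lambda>x y. THE z. z \<in> Q \<and> f x z = y)
      else if i = 2 then (\<lambda>x y. THE z. z \<in> Q \<and> f z y = x)
      else if i = 3 then (\<lambda>x y. THE z. z \<in> Q \<and> f z x = y)
      else if i = 4 then (\<lambda>x y. THE z. z \<in> Q \<and> f y z = x)
      else (\<lambda>x y. f y x))"

lemma parastrophe_iff:
  assumes "quasigroup Q f" "x \<in> Q" "y \<in> Q" "z \<in> Q"
  shows "parastrophe Q f 1 x y = z \<longleftrightarrow> f x z = y"
    and "parastrophe Q f 2 x y = z \<longleftrightarrow> f z y = x"
    and "parastrophe Q f 3 x y = z \<longleftrightarrow> f z x = y"
    and "parastrophe Q f 4 x y = z \<longleftrightarrow> f y z = x"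
    and "parastrophe Q f 5 x y = z \<longleftrightarrow> f y x = z"
proof -
  have THE_iff: "(THE w. P w) = z \<longleftrightarrow> P z" if "\<exists>!w. P w" for P :: "'a \<Rightarrow> bool"
  proof
    show "P z" if "(THE w. P w) = z"
      using theI'[OF \<open>\<exists>!w. P w\<close>] unfolding that .
    show "(THE w. P w) = z" if "P z"
      by (rule the1_equality[OF \<open>\<exists>!w. P w\<close> that])
  qed
  note q = assms(1)[unfolded quasigroup_def]
  note left = q[THEN conjunct2, THEN conjunct1, rule_format]
    and right = q[THEN conjunct2, THEN conjunct2, rule_format]
  show "parastrophe Q f 1 x y = z \<longleftrightarrow> f x z = y"
    using THE_iff[OF left[OF assms(2,3)]] assms(4) by (simp add: parastrophe_def)
  show "parastrophe Q f 2 x y = z \<longleftrightarrow> f z y = x"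
    using THE_iff[OF right[OF assms(3,2)]] assms(4) by (simp add: parastrophe_def)
  show "parastrophe Q f 3 x y = z \<longleftrightarrow> f z x = y"
    using THE_iff[OF right[OF assms(2,3)]] assms(4) by (simp add: parastrophe_def)
  show "parastrophe Q f 4 x y = z \<longleftrightarrow> f y z = x"
    using THE_iff[OF left[OF assms(3,2)]] assms(4) by (simp add: parastrophe_def)
  show "parastrophe Q f 5 x y = z \<longleftrightarrow> f y x = z"
    by (simp add: parastrophe_def)
qed

definition parastrophes :: "'a set \<Rightarrow> ('a \<Rightarrow> 'a \<Rightarrow> 'a) \<Rightarrow> ('a \<Rightarrow> 'a \<Rightarrow> 'a) set" where
  "parastrophes Q f = parastrophe Q f ` {0..5}"

(* Values of operations outside Q are irrelevant to isotopic, so they affect neither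
   the number of classes nor which parastrophes lie in the same class. *)
definition parastrophe_classes ::
    "'a set \<Rightarrow> ('a \<Rightarrow> 'a \<Rightarrow> 'a) \<Rightarrow> ('a \<Rightarrow> 'a \<Rightarrow> 'a) set set" where
  "parastrophe_classes Q f =
     parastrophes Q f //
       {(g, h). g \<in> parastrophes Q f \<and> h \<in> parastrophes Q f \<and> isotopic Q g h}"

end

theory Submission
  imports Defs
begin

text \<open>
  Anti-isotopy of $f$ to $g$ is isotopy of $f_5$ to $g$. The group $S_3$ of parastrophy operations
  acts on isotopy classes, so the indices $i$ with $Q \approx Q_i$ form a subgroup of $S_3$, the
  classes correspond to its cosets, and there are three of them exactly if the subgroup has
  order two, i.e. is generated by one of the transpositions $1$, $2$, $5$.
\<close>

section \<open>Parastrophes as quasigroups and their composition\<close>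

lemma quasigroup_closed:
  "quasigroup Q f \<Longrightarrow> x \<in> Q \<Longrightarrow> y \<in> Q \<Longrightarrow> f x y \<in> Q"
  by (simp add: quasigroup_def)

lemma parastrophe_closed:
  assumes "quasigroup Q f" "x \<in> Q" "y \<in> Q"
  shows "parastrophe Q f i x y \<in> Q"
proof -
  have left: "\<exists>!z. z \<in> Q \<and> f a z = b" and right: "\<exists>!z. z \<in> Q \<and> f z a = b"
    if "a \<in> Q" "b \<in> Q" for a b
    using assms(1) that by (simp_all add: quasigroup_def)
  note the = left[THEN theI', THEN conjunct1] right[THEN theI', THEN conjunct1]
  show ?thesis
    unfolding parastrophe_def
    by (simp add: the quasigroup_closed assms)
qed

text \<open>Unique solvability becomes a pair of equivalences once the two divisions
  \<open>l\<close> and \<open>r\<close> are named. This suits parastrophes, whose divisions are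
  again parastrophes.\<close>

lemma quasigroupI:
  assumes "\<And>x y. x \<in> Q \<Longrightarrow> y \<in> Q \<Longrightarrow> f x y \<in> Q"
    and "\<And>x y. x \<in> Q \<Longrightarrow> y \<in> Q \<Longrightarrow> l x y \<in> Q"
    and "\<And>x y. x \<in> Q \<Longrightarrow> y \<in> Q \<Longrightarrow> r x y \<in> Q"
    and "\<And>x y z. x \<in> Q \<Longrightarrow> y \<in> Q \<Longrightarrow> z \<in> Q \<Longrightarrow> f x z = y \<longleftrightarrow> z = l x y"
    and "\<And>x y z. x \<in> Q \<Longrightarrow> y \<in> Q \<Longrightarrow> z \<in> Q \<Longrightarrow> f z x = y \<longleftrightarrow> z = r x y"
  shows "quasigroup Q f"
proof -
  have "\<exists>!z. z \<in> Q \<and> f a z = b" if "a \<in> Q" "b \<in> Q" for a b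
    using assms(2)[OF that] assms(4)[OF that] by (intro ex1I[of _ "l a b"]) auto
  moreover have "\<exists>!z. z \<in> Q \<and> f z a = b" if "a \<in> Q" "b \<in> Q" for a b
    using assms(3)[OF that] assms(5)[OF that] by (intro ex1I[of _ "r a b"]) auto
  ultimately show ?thesis
    using assms(1)
    by (simp add: quasigroup_def)
qed

lemma parastrophe_0 [simp]: "parastrophe Q f 0 = f"
  by (simp add: parastrophe_def)

text \<open>Operation 1 is the left division of \<open>f\<close>. Its own left division is
  \<open>f\<close> again, and its right division is parastrophe 2, since both equations reduce to
  \<open>f z y = x\<close>.\<close>

lemma quasigroup_parastrophe_1:
  assumes q: "quasigroup Q f"
  shows "quasigroup Q (parastrophe Q f 1)"
proof (rule quasigroupI[where l = f and r = "parastrophe Q f 2"])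
  fix x y z assume xyz: "x \<in> Q" "y \<in> Q" "z \<in> Q"
  show "parastrophe Q f 1 x z = y \<longleftrightarrow> z = f x y"
    and "parastrophe Q f 1 z x = y \<longleftrightarrow> z = parastrophe Q f 2 x y"
    using parastrophe_iff(1)[OF q xyz(1,3,2)] parastrophe_iff(1)[OF q xyz(3,1,2)]
      parastrophe_iff(2)[OF q xyz] by auto
qed (simp_all add: q parastrophe_closed quasigroup_closed)

lemma quasigroup_parastrophe_5:
  "quasigroup Q f \<Longrightarrow> quasigroup Q (parastrophe Q f 5)"
  by (simp add: quasigroup_def parastrophe_def)

text \<open>Except for the first identity, unfolding suffices: swapping arguments turns one defining
  description into another. The first uses that \<open>f\<close> solves the equation defining the
  outer left division, which requires arguments in \<open>Q\<close>.\<close>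

lemma parastrophe_parastrophe:
  assumes q: "quasigroup Q f" and xy: "x \<in> Q" "y \<in> Q"
  shows "parastrophe Q (parastrophe Q f 1) 1 x y = f x y"
    and "parastrophe Q (parastrophe Q f 1) 5 x y = parastrophe Q f 4 x y"
    and "parastrophe Q (parastrophe Q f 4) 5 x y = parastrophe Q f 1 x y"
    and "parastrophe Q (parastrophe Q f 5) 1 x y = parastrophe Q f 3 x y"
    and "parastrophe Q (parastrophe Q f 3) 5 x y = parastrophe Q f 2 x y"
    and "parastrophe Q (parastrophe Q f 2) 5 x y = parastrophe Q f 3 x y"
    and "parastrophe Q (parastrophe Q f 5) 5 x y = f x y"
proof -
  show "parastrophe Q (parastrophe Q f 1) 1 x y = f x y"
    using parastrophe_iff(1)[OF quasigroup_parastrophe_1[OF q] xy quasigroup_closed[OF q xy]]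
      parastrophe_iff(1)[OF q xy(1) quasigroup_closed[OF q xy] xy(2)] by simp
qed (simp_all add: parastrophe_def)

text \<open>The composition identities are stated only on \<open>Q\<close>, so the quasigroup
  property must be transferable between operations that agree there.\<close>

lemma quasigroup_cong:
  assumes "quasigroup Q f" "\<And>x y. x \<in> Q \<Longrightarrow> y \<in> Q \<Longrightarrow> g x y = f x y"
  shows "quasigroup Q g"
proof -
  have "(x \<in> Q \<and> g a x = b) = (x \<in> Q \<and> f a x = b)"
    "(x \<in> Q \<and> g x a = b) = (x \<in> Q \<and> f x a = b)" if "a \<in> Q" for a b x
    using assms(2) that by auto
  with assms show ?thesis by (simp add: quasigroup_def)
qed

text \<open>Operations 1 and 5 generate the others: 3 is 5 followed by 1, 2 is 3 followed by 5, and
  4 is 1 followed by 5.\<close>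

lemma quasigroup_parastrophe:
  assumes q: "quasigroup Q f"
  shows "quasigroup Q (parastrophe Q f i)"
proof -
  note q1 = quasigroup_parastrophe_1 and q5 = quasigroup_parastrophe_5
  note eq = parastrophe_parastrophe[OF q]
  have q3: "quasigroup Q (parastrophe Q f 3)"
    by (rule quasigroup_cong[OF q1[OF q5[OF q]]]) (simp only: eq)
  have q2: "quasigroup Q (parastrophe Q f 2)"
    by (rule quasigroup_cong[OF q5[OF q3]]) (simp only: eq)
  have q4: "quasigroup Q (parastrophe Q f 4)"
    by (rule quasigroup_cong[OF q5[OF q1[OF q]]]) (simp only: eq)
  \<comment> \<open>All indices from 5 on fall into the last branch of the definition, so the result
    covers every natural number \<open>i\<close>.\<close>
  have large: "parastrophe Q f i = parastrophe Q f 5" if "5 \<le> i"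
    using that by (simp add: parastrophe_def)
  consider "i = 0" | "i = 1" | "i = 2" | "i = 3" | "i = 4" | "5 \<le> i"
    by linarith
  then show ?thesis
    using q q1[OF q] q2 q3 q4 q5[OF q] large by cases (simp_all del: One_nat_def)
qed

text \<open>These complete the table of left divisions of parastrophes. The outer description has a
  unique solution because the inner parastrophe is already known to be a quasigroup.\<close>

lemma parastrophe_parastrophe_1:
  assumes q: "quasigroup Q f" and xy: "x \<in> Q" "y \<in> Q"
  shows "parastrophe Q (parastrophe Q f 2) 1 x y = parastrophe Q f 4 x y"
    and "parastrophe Q (parastrophe Q f 4) 1 x y = parastrophe Q f 2 x y"
    and "parastrophe Q (parastrophe Q f 3) 1 x y = parastrophe Q f 5 x y"
proof -
  have iff: "parastrophe Q (parastrophe Q f i) 1 x y = z \<longleftrightarrow> parastrophe Q f i x z = y"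
    if "z \<in> Q" for i z
    using parastrophe_iff(1)[OF quasigroup_parastrophe[OF q] xy that] .
  \<comment> \<open>A candidate for the outer value is checked by substitution. In each use below,
    the required equation and the characterisation of the candidate reduce to the same equation for
    \<open>f\<close>.\<close>
  have *: "parastrophe Q (parastrophe Q f i) 1 x y = parastrophe Q f j x y"
    if "parastrophe Q f i x (parastrophe Q f j x y) = y" for i j
    using iff that parastrophe_closed[OF q xy] by blast
  note iffs = parastrophe_iff[OF q xy(1) parastrophe_closed[OF q xy] xy(2)]
    and iffs' = parastrophe_iff[OF q xy parastrophe_closed[OF q xy]]
  show "parastrophe Q (parastrophe Q f 2) 1 x y = parastrophe Q f 4 x y"
    by (rule *) (use iffs(2)[of 4] iffs'(4)[of 4] in simp)
  show "parastrophe Q (parastrophe Q f 4) 1 x y = parastrophe Q f 2 x y"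
    by (rule *) (use iffs(4)[of 2] iffs'(2)[of 2] in simp)
  show "parastrophe Q (parastrophe Q f 3) 1 x y = parastrophe Q f 5 x y"
    by (rule *) (use iffs(3)[of 5] iffs'(5)[of 5] in simp)
qed

section \<open>Isotopy is an equivalence compatible with parastrophy\<close>

lemma isotopic_if_eq_on:
  assumes "\<And>x y. x \<in> Q \<Longrightarrow> y \<in> Q \<Longrightarrow> g x y = f x y"
  shows "isotopic Q f g"
  unfolding isotopic_def
  by (rule exI[of _ id], rule exI[of _ id], rule exI[of _ id]) (simp add: assms)

lemma isotopic_refl: "isotopic Q f f"
  by (rule isotopic_if_eq_on) simp

lemma isotopic_trans:
  assumes "isotopic Q f g" "isotopic Q g h"
  shows "isotopic Q f h"
proof -
  obtain a b c where 1: "bij_betw a Q Q" "bij_betw b Q Q" "bij_betw c Q Q"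
    "\<And>x y. x \<in> Q \<Longrightarrow> y \<in> Q \<Longrightarrow> g (a x) (b y) = c (f x y)"
    using assms(1) unfolding isotopic_def by blast
  obtain a' b' c' where 2: "bij_betw a' Q Q" "bij_betw b' Q Q" "bij_betw c' Q Q"
    "\<And>x y. x \<in> Q \<Longrightarrow> y \<in> Q \<Longrightarrow> h (a' x) (b' y) = c' (g x y)"
    using assms(2) unfolding isotopic_def by blast
  show ?thesis
    unfolding isotopic_def
  proof (intro exI conjI ballI)
    show "bij_betw (a' \<circ> a) Q Q" "bij_betw (b' \<circ> b) Q Q" "bij_betw (c' \<circ> c) Q Q"
      using 1(1-3) 2(1-3) by (auto intro: bij_betw_trans)
    show "h ((a' \<circ> a) x) ((b' \<circ> b) y) = (c' \<circ> c) (f x y)" if "x \<in> Q" "y \<in> Q" for x y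
      using that 1(1,2) 1(4)[OF that] 2(4)[of "a x" "b y"] by (auto dest: bij_betwE)
  qed
qed

lemma isotopic_sym:
  assumes q: "quasigroup Q f" and "isotopic Q f g"
  shows "isotopic Q g f"
proof -
  obtain a b c where 1: "bij_betw a Q Q" "bij_betw b Q Q" "bij_betw c Q Q"
    "\<And>x y. x \<in> Q \<Longrightarrow> y \<in> Q \<Longrightarrow> g (a x) (b y) = c (f x y)"
    using assms(2) unfolding isotopic_def by blast
  define a' b' c' where "a' = inv_into Q a" "b' = inv_into Q b" "c' = inv_into Q c"
  note inv = this
  have bij: "bij_betw a' Q Q" "bij_betw b' Q Q" "bij_betw c' Q Q"
    using 1 by (simp_all add: inv bij_betw_inv_into)
  have "f (a' x) (b' y) = c' (g x y)" if "x \<in> Q" "y \<in> Q" for x y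
  proof -
    have in_Q: "a' x \<in> Q" "b' y \<in> Q"
      using bij that by (auto dest: bij_betwE)
    have "g x y = c (f (a' x) (b' y))"
      using 1(4)[OF in_Q] 1(1,2) that by (simp add: inv bij_betw_inv_into_right)
    \<comment> \<open>Closure of \<open>f\<close> puts \<open>f (a' x) (b' y)\<close> into
      \<open>Q\<close>, where \<open>c'\<close> cancels \<open>c\<close>.\<close>
    then show ?thesis
      using quasigroup_closed[OF q in_Q] 1(3) by (simp add: inv bij_betw_inv_into_left)
  qed
  with bij show ?thesis
    unfolding isotopic_def by blast
qed

text \<open>The maps \<open>a\<close>, \<open>b\<close>, \<open>c\<close> act on the three entries
  of \<open>f x z = y\<close>. Left division exchanges the second argument with the result, so the
  new isotopy is \<open>a\<close>, \<open>c\<close>, \<open>b\<close>.\<close>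

lemma isotopic_parastrophe_1:
  assumes f: "quasigroup Q f" and g: "quasigroup Q g" and "isotopic Q f g"
  shows "isotopic Q (parastrophe Q f 1) (parastrophe Q g 1)"
proof -
  obtain a b c where 1: "bij_betw a Q Q" "bij_betw b Q Q" "bij_betw c Q Q"
    "\<And>x y. x \<in> Q \<Longrightarrow> y \<in> Q \<Longrightarrow> g (a x) (b y) = c (f x y)"
    using assms(3) unfolding isotopic_def by blast
  have "parastrophe Q g 1 (a x) (c y) = b (parastrophe Q f 1 x y)"
    if xy: "x \<in> Q" "y \<in> Q" for x y
  proof -
    let ?z = "parastrophe Q f 1 x y"
    have z: "?z \<in> Q" using parastrophe_closed[OF f xy] .
    have "f x ?z = y" using parastrophe_iff(1)[OF f xy z] by simp
    then have "g (a x) (b ?z) = c y" using 1(4)[OF xy(1) z] by simp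
    moreover have "a x \<in> Q" "c y \<in> Q" "b ?z \<in> Q" using 1 xy z by (auto dest: bij_betwE)
    ultimately show ?thesis using parastrophe_iff(1)[OF g] by simp
  qed
  with 1 show ?thesis
    unfolding isotopic_def by blast
qed

text \<open>Exchanging the arguments exchanges \<open>a\<close> and \<open>b\<close> in the
  isotopy.\<close>

lemma isotopic_parastrophe_5:
  assumes "isotopic Q f g"
  shows "isotopic Q (parastrophe Q f 5) (parastrophe Q g 5)"
proof -
  obtain a b c where "bij_betw a Q Q" "bij_betw b Q Q" "bij_betw c Q Q"
    "\<forall>y\<in>Q. \<forall>x\<in>Q. g (a y) (b x) = c (f y x)"
    using assms unfolding isotopic_def by blast
  then show ?thesis
    unfolding isotopic_def
    by (intro exI[of _ b] exI[of _ a] exI[of _ c]) (simp add: parastrophe_def)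
qed

lemma anti_isotopic_iff_isotopic:
  "anti_isotopic Q f g \<longleftrightarrow> isotopic Q (parastrophe Q f 5) g"
  by (simp add: anti_isotopic_def isotopic_def parastrophe_def)

lemma isotopic_cong:
  assumes "isotopic Q f g"
    and "\<And>x y. x \<in> Q \<Longrightarrow> y \<in> Q \<Longrightarrow> f x y = f' x y"
    and "\<And>x y. x \<in> Q \<Longrightarrow> y \<in> Q \<Longrightarrow> g x y = g' x y"
  shows "isotopic Q f' g'"
proof -
  have "isotopic Q f' f" "isotopic Q g g'"
    using assms(2,3) by (auto intro: isotopic_if_eq_on)
  with assms(1) show ?thesis by (blast intro: isotopic_trans)
qed

section \<open>The action of $S_3$ on indices\<close>

text \<open>Multiplication by the transpositions 1 and 5, which generate $S_3$; junk for arguments above 5.\<close>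

definition mult1 :: "nat \<Rightarrow> nat" where
  "mult1 i = [1, 0, 4, 5, 2, 3] ! i"

definition mult5 :: "nat \<Rightarrow> nat" where
  "mult5 i = [5, 4, 3, 2, 1, 0] ! i"

lemma mult_simps:
  "mult1 0 = 1" "mult1 1 = 0" "mult1 2 = 4" "mult1 3 = 5" "mult1 4 = 2" "mult1 5 = 3"
  "mult5 0 = 5" "mult5 1 = 4" "mult5 2 = 3" "mult5 3 = 2" "mult5 4 = 1" "mult5 5 = 0"
  by (simp_all add: mult1_def mult5_def)

lemma index_cases:
  fixes i :: nat
  assumes "i \<le> 5"
  obtains "i = 0" | "i = 1" | "i = 2" | "i = 3" | "i = 4" | "i = 5"
  using assms by linarith

lemma mult_involution:
  assumes "i \<le> 5"
  shows "mult1 i \<le> 5" "mult5 i \<le> 5" "mult1 (mult1 i) = i" "mult5 (mult5 i) = i"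
  using assms by (cases i rule: index_cases; simp only: mult_simps; simp)+

text \<open>This ties the numeric lists to the operations: ten composition identities, and two
  trivial ones for \<open>i = 0\<close>.\<close>

lemma parastrophe_mult:
  assumes q: "quasigroup Q f" and "i \<le> 5" and xy: "x \<in> Q" "y \<in> Q"
  shows "parastrophe Q (parastrophe Q f i) 1 x y = parastrophe Q f (mult1 i) x y"
    and "parastrophe Q (parastrophe Q f i) 5 x y = parastrophe Q f (mult5 i) x y"
  using \<open>i \<le> 5\<close>
  by (cases i rule: index_cases; simp only: mult_simps parastrophe_0
      parastrophe_parastrophe[OF q xy] parastrophe_parastrophe_1[OF q xy])+

lemma isotopic_mult:
  assumes q: "quasigroup Q f" and ij: "i \<le> 5" "j \<le> 5"
    and iso: "isotopic Q (parastrophe Q f i) (parastrophe Q f j)"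
  shows "isotopic Q (parastrophe Q f (mult1 i)) (parastrophe Q f (mult1 j))"
    and "isotopic Q (parastrophe Q f (mult5 i)) (parastrophe Q f (mult5 j))"
proof -
  note qp = quasigroup_parastrophe[OF q]
  show "isotopic Q (parastrophe Q f (mult1 i)) (parastrophe Q f (mult1 j))"
    using isotopic_cong[OF isotopic_parastrophe_1[OF qp qp iso] parastrophe_mult(1)[OF q ij(1)]
        parastrophe_mult(1)[OF q ij(2)]] .
  show "isotopic Q (parastrophe Q f (mult5 i)) (parastrophe Q f (mult5 j))"
    using isotopic_cong[OF isotopic_parastrophe_5[OF iso] parastrophe_mult(2)[OF q ij(1)]
        parastrophe_mult(2)[OF q ij(2)]] .
qed

text \<open>The implications hold because two distinct transpositions generate $S_3$, where 3 has order three.\<close>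

lemma isotopic_parastrophe_table:
  assumes q: "quasigroup Q f"
    and E: "\<And>i j. E i j \<longleftrightarrow> isotopic Q (parastrophe Q f i) (parastrophe Q f j)"
  shows
    "E 1 2 = E 0 3" "E 1 3 = E 0 5" "E 1 4 = E 0 2" "E 1 5 = E 0 3"
    "E 2 3 = E 0 1" "E 2 4 = E 0 5" "E 2 5 = E 0 3"
    "E 3 4 = E 0 3" "E 3 5 = E 0 2" "E 4 5 = E 0 1" "E 0 4 = E 0 3"
    "E 0 1 \<Longrightarrow> E 0 2 \<Longrightarrow> E 0 3" "E 0 1 \<Longrightarrow> E 0 5 \<Longrightarrow> E 0 3" "E 0 2 \<Longrightarrow> E 0 5 \<Longrightarrow> E 0 3"
proof -
  have sym: "E i j \<longleftrightarrow> E j i" for i j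
    unfolding E using isotopic_sym[OF quasigroup_parastrophe[OF q]] by blast
  have trans: "E i j \<Longrightarrow> E j k \<Longrightarrow> E i k" for i j k
    unfolding E by (rule isotopic_trans)
  have m1: "E (mult1 i) (mult1 j)" and m5: "E (mult5 i) (mult5 j)"
    if "i \<le> 5" "j \<le> 5" "E i j" for i j
    using isotopic_mult[OF q that(1,2)] that(3) by (simp_all only: E)
  \<comment> \<open>Both multiplications are involutions, so applying the implication twice returns
    to \<open>i\<close>, \<open>j\<close> and gives the converse.\<close>
  have iff1: "E i j \<longleftrightarrow> E (mult1 i) (mult1 j)" and iff5: "E i j \<longleftrightarrow> E (mult5 i) (mult5 j)"
    if "i \<le> 5" "j \<le> 5" for i j
  proof -
    note inv = mult_involution[OF that(1)] mult_involution[OF that(2)]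
    show "E i j \<longleftrightarrow> E (mult1 i) (mult1 j)"
      using m1[OF that] m1[OF inv(1,5), unfolded inv(3,7)] by (rule iffI)
    show "E i j \<longleftrightarrow> E (mult5 i) (mult5 j)"
      using m5[OF that] m5[OF inv(2,6), unfolded inv(4,8)] by (rule iffI)
  qed
  \<comment> \<open>Up to symmetry, the 15 pairs of distinct indices form four orbits, with
    representatives (0,1), (0,2), (0,5) and (0,3), of sizes 3, 3, 3 and 6. The eleven equations link
    each orbit together.\<close>
  have orbits: "E 0 1 = E 5 4" "E 5 4 = E 3 2" "E 0 2 = E 1 4" "E 0 2 = E 5 3"
    "E 0 5 = E 1 3" "E 1 3 = E 4 2" "E 0 3 = E 1 5" "E 1 5 = E 4 0" "E 4 0 = E 2 1"
    "E 2 1 = E 3 4" "E 3 4 = E 5 2"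
    using iff5[of 0 1] iff1[of 5 4] iff1[of 0 2] iff5[of 0 2] iff1[of 0 5] iff5[of 1 3]
      iff1[of 0 3] iff5[of 1 5] iff1[of 4 0] iff5[of 2 1] iff1[of 3 4]
    unfolding mult_simps by simp_all
  show t: "E 1 2 = E 0 3" "E 1 3 = E 0 5" "E 1 4 = E 0 2" "E 1 5 = E 0 3"
    "E 2 3 = E 0 1" "E 2 4 = E 0 5" "E 2 5 = E 0 3"
    "E 3 4 = E 0 3" "E 3 5 = E 0 2" "E 4 5 = E 0 1" "E 0 4 = E 0 3"
    using orbits sym[of 1 2] sym[of 2 3] sym[of 2 4] sym[of 2 5] sym[of 3 5] sym[of 4 5]
      sym[of 0 4]
    by blast+
  \<comment> \<open>Passing through 0 yields \<open>E 1 2\<close>, \<open>E 1 5\<close> or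
    \<open>E 2 5\<close>, all in the orbit of \<open>E 0 3\<close>.\<close>
  show "E 0 1 \<Longrightarrow> E 0 2 \<Longrightarrow> E 0 3" "E 0 1 \<Longrightarrow> E 0 5 \<Longrightarrow> E 0 3" "E 0 2 \<Longrightarrow> E 0 5 \<Longrightarrow> E 0 3"
    using t trans[of 1 0 2] trans[of 1 0 5] trans[of 2 0 5] sym[of 1 0] sym[of 2 0] by blast+
qed

section \<open>Counting and listing the classes\<close>

text \<open>Replaces the quotient of a set of operations by a family over indices. \<open>P\<close>
  may take the same value at several indices.\<close>

lemma quotient_eq_image:
  "(P ` I) // {(g, h). g \<in> P ` I \<and> h \<in> P ` I \<and> R g h} =
     (\<lambda>i. P ` {j \<in> I. R (P i) (P j)}) ` I"
  unfolding quotient_def by blast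

text \<open>Rewrite rules that evaluate the set of indices related to a given one as soon as the
  truth values are known.\<close>

lemma filter_insert:
  "{j \<in> insert a A. R j} = (if R a then insert a {j \<in> A. R j} else {j \<in> A. R j})"
  "{j \<in> {}. R j} = {}"
  by auto

theorem theorem2p12:
  fixes Q :: "'a set" and f :: "'a \<Rightarrow> 'a \<Rightarrow> 'a"
  assumes "quasigroup Q f"
  shows "(card (parastrophe_classes Q f) = 3 \<longleftrightarrow>
     (\<not> anti_isotopic Q f f \<and> anti_isotopic Q f (parastrophe Q f 3) \<and>
      (\<forall>i\<in>{1, 2, 4}. \<not> anti_isotopic Q f (parastrophe Q f i))) \<or>
     (\<not> anti_isotopic Q f f \<and> anti_isotopic Q f (parastrophe Q f 4) \<and>
      (\<forall>i\<in>{1, 2, 3}. \<not> anti_isotopic Q f (parastrophe Q f i))) \<or>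
     (anti_isotopic Q f f \<and> anti_isotopic Q f (parastrophe Q f 5) \<and>
      (\<forall>i\<in>{1, 2, 3, 4}. \<not> anti_isotopic Q f (parastrophe Q f i)))) \<and>
    (\<not> anti_isotopic Q f f \<and> anti_isotopic Q f (parastrophe Q f 3) \<and>
      (\<forall>i\<in>{1, 2, 4}. \<not> anti_isotopic Q f (parastrophe Q f i)) \<longrightarrow>
      parastrophe_classes Q f =
        {{f, parastrophe Q f 2},
         {parastrophe Q f 1, parastrophe Q f 4},
         {parastrophe Q f 3, parastrophe Q f 5}}) \<and>
    (\<not> anti_isotopic Q f f \<and> anti_isotopic Q f (parastrophe Q f 4) \<and>
      (\<forall>i\<in>{1, 2, 3}. \<not> anti_isotopic Q f (parastrophe Q f i)) \<longrightarrow>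
      parastrophe_classes Q f =
        {{f, parastrophe Q f 1},
         {parastrophe Q f 2, parastrophe Q f 3},
         {parastrophe Q f 4, parastrophe Q f 5}}) \<and>
    (anti_isotopic Q f f \<and> anti_isotopic Q f (parastrophe Q f 5) \<and>
      (\<forall>i\<in>{1, 2, 3, 4}. \<not> anti_isotopic Q f (parastrophe Q f i)) \<longrightarrow>
      parastrophe_classes Q f =
        {{f, parastrophe Q f 5},
         {parastrophe Q f 1, parastrophe Q f 3},
         {parastrophe Q f 2, parastrophe Q f 4}})"
proof -
  define P where "P = parastrophe Q f"
  define E where "E = (\<lambda>i j. isotopic Q (P i) (P j))"
  define C where "C = (\<lambda>i. P ` {j \<in> {0..5}. E i j})"
  have E_iff: "E i j \<longleftrightarrow> isotopic Q (parastrophe Q f i) (parastrophe Q f j)" for i j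
    by (simp add: E_def P_def)
  note table = isotopic_parastrophe_table[OF assms E_iff]
  have refl: "E i i" for i
    unfolding E_def by (rule isotopic_refl)
  have sym: "E i j = E j i" for i j
    unfolding E_iff using isotopic_sym[OF quasigroup_parastrophe[OF assms]] by blast
  have trans: "E i j \<Longrightarrow> E j k \<Longrightarrow> E i k" for i j k
    unfolding E_def by (rule isotopic_trans)
  \<comment> \<open>With the upper half from \<open>table\<close> and with \<open>refl\<close>, all
    36 values of \<open>E\<close> are expressed by \<open>E 0 1\<close>, \<open>E 0 2\<close>,
    \<open>E 0 3\<close> and \<open>E 0 5\<close>.\<close>
  have "E 1 0 = E 0 1" "E 2 0 = E 0 2" "E 3 0 = E 0 3" "E 4 0 = E 0 3" "E 5 0 = E 0 5"
    "E 2 1 = E 0 3" "E 3 1 = E 0 5" "E 4 1 = E 0 2" "E 5 1 = E 0 3"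
    "E 3 2 = E 0 1" "E 4 2 = E 0 5" "E 5 2 = E 0 3"
    "E 4 3 = E 0 3" "E 5 3 = E 0 2" "E 5 4 = E 0 1"
    by (simp_all only: sym[of 1 0] sym[of 2 0] sym[of 3 0] sym[of 4 0] sym[of 5 0] sym[of 2 1]
        sym[of 3 1] sym[of 4 1] sym[of 5 1] sym[of 3 2] sym[of 4 2] sym[of 5 2] sym[of 4 3]
        sym[of 5 3] sym[of 5 4] table(1-11))
  note E_simps = this table(1-11) refl
  have indices: "{0..5::nat} = {0, 1, 2, 3, 4, 5}"
    by auto
  have classes: "parastrophe_classes Q f = C ` {0..5}"
    unfolding parastrophe_classes_def parastrophes_def quotient_eq_image
    by (simp only: C_def E_def P_def)
  have C_eq: "C i = C j \<longleftrightarrow> E i j" if "i \<le> 5" "j \<le> 5" for i j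
  proof
    assume "C i = C j"
    moreover have "P j \<in> C j"
      using that refl by (simp add: C_def)
    \<comment> \<open>The index \<open>k\<close> may differ from \<open>j\<close>, but
      \<open>E\<close> depends only on the operations, so \<open>P j = P k\<close> turns
      \<open>E i k\<close> into \<open>E i j\<close>.\<close>
    ultimately obtain k where "P j = P k" "E i k"
      unfolding C_def by blast
    then show "E i j"
      by (simp add: E_def)
  next
    assume "E i j"
    then have "E i k \<longleftrightarrow> E j k" for k
      using sym trans by blast
    then show "C i = C j"
      by (simp add: C_def)
  qed
  have card: "card (parastrophe_classes Q f) = card {C 0, C 1, C 2, C 3, C 4, C 5}"
    unfolding classes indices by (simp only: image_insert image_empty)
  have P0: "f = P 0"
    by (simp add: P_def)
  have anti: "anti_isotopic Q f (P i) = E 5 i" for i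
    by (simp add: anti_isotopic_iff_isotopic E_def P_def)
  have anti0: "anti_isotopic Q f f = E 5 0"
    using anti[of 0] P0 by simp
  have count: "card (parastrophe_classes Q f) = 3 \<longleftrightarrow>
      \<not> E 0 3 \<and> (E 0 1 \<or> E 0 2 \<or> E 0 5)"
  proof -
    have none: "card (parastrophe_classes Q f) \<noteq> 3"
      if "\<not> E 0 1" "\<not> E 0 2" "\<not> E 0 3" "\<not> E 0 5"
      unfolding card using that by (simp add: card_insert_if C_eq E_simps del: One_nat_def)
    have one: "card (parastrophe_classes Q f) = 3"
      if "E 0 1" "\<not> E 0 2" "\<not> E 0 3" "\<not> E 0 5"
    proof -
      have "C 1 = C 0" "C 3 = C 2" "C 5 = C 4"
        using that by (simp_all add: C_eq E_simps del: One_nat_def)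
      with that show ?thesis
        unfolding card by (simp add: card_insert_if C_eq E_simps del: One_nat_def)
    qed
    have two: "card (parastrophe_classes Q f) = 3"
      if "\<not> E 0 1" "E 0 2" "\<not> E 0 3" "\<not> E 0 5"
    proof -
      have "C 2 = C 0" "C 4 = C 1" "C 5 = C 3"
        using that by (simp_all add: C_eq E_simps del: One_nat_def)
      with that show ?thesis
        unfolding card by (simp add: card_insert_if C_eq E_simps del: One_nat_def)
    qed
    have five: "card (parastrophe_classes Q f) = 3"
      if "\<not> E 0 1" "\<not> E 0 2" "\<not> E 0 3" "E 0 5"
    proof -
      have "C 5 = C 0" "C 3 = C 1" "C 4 = C 2"
        using that by (simp_all add: C_eq E_simps del: One_nat_def)
      with that show ?thesis
        unfolding card by (simp add: card_insert_if C_eq E_simps del: One_nat_def)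
    qed
    \<comment> \<open>The subgroup now contains the elements of order three, so only
      \<open>C 0\<close> and \<open>C 1\<close> can remain: at most two classes.\<close>
    have three: "card (parastrophe_classes Q f) \<noteq> 3" if "E 0 3"
    proof -
      have "C 3 = C 0" "C 4 = C 0" "C 2 = C 1" "C 5 = C 1"
        using that by (simp_all add: C_eq E_simps del: One_nat_def)
      then show ?thesis
        unfolding card by (simp add: card_insert_if)
    qed
    show ?thesis
      \<comment> \<open>The three implications in \<open>table\<close> rule out two transpositions
        at once unless \<open>E 0 3\<close> holds, so the five cases are exhaustive.\<close>
      using none one two three five table(12-14) by metis
  qed
  \<comment> \<open>These rules evaluate each \<open>C i\<close> to an explicit set;
    \<open>insert_commute\<close> then identifies the sets listed more than once.\<close>
  note C_simps = C_def indices filter_insert E_simps if_True if_False image_insert image_empty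
  have classes_2: "parastrophe_classes Q f = {{f, P 2}, {P 1, P 4}, {P 3, P 5}}"
    if "\<not> E 0 1" "E 0 2" "\<not> E 0 3" "\<not> E 0 5"
    unfolding classes using that
    by (simp only: C_simps) (simp add: P0[symmetric] insert_commute del: One_nat_def)
  have classes_1: "parastrophe_classes Q f = {{f, P 1}, {P 2, P 3}, {P 4, P 5}}"
    if "E 0 1" "\<not> E 0 2" "\<not> E 0 3" "\<not> E 0 5"
    unfolding classes using that
    by (simp only: C_simps) (simp add: P0[symmetric] insert_commute del: One_nat_def)
  have classes_5: "parastrophe_classes Q f = {{f, P 5}, {P 1, P 3}, {P 2, P 4}}"
    if "\<not> E 0 1" "\<not> E 0 2" "\<not> E 0 3" "E 0 5"
    unfolding classes using that
    by (simp only: C_simps) (simp add: P0[symmetric] insert_commute del: One_nat_def)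
  have bounded: "(\<forall>i\<in>{1, 2, 4}. \<not> E 5 i) \<longleftrightarrow> \<not> E 0 1 \<and> \<not> E 0 3"
    "(\<forall>i\<in>{1, 2, 3}. \<not> E 5 i) \<longleftrightarrow> \<not> E 0 2 \<and> \<not> E 0 3"
    "(\<forall>i\<in>{1, 2, 3, 4}. \<not> E 5 i) \<longleftrightarrow> \<not> E 0 1 \<and> \<not> E 0 2 \<and> \<not> E 0 3"
    by (auto simp: E_simps simp del: One_nat_def)
  \<comment> \<open>Since \<open>E 5 3 = E 0 2\<close>, \<open>E 5 4 = E 0 1\<close> and
    \<open>E 5 0 = E 0 5\<close>, the three listed conditions say that the subgroup is generated by
    2, by 1 and by 5, in this order.\<close>
  show ?thesis
    unfolding P_def[symmetric] anti anti0 count bounded E_simps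
  proof (intro conjI impI, goal_cases)
    case 1
    show ?case
      using table(12-14) refl[of 5] by blast
  next
    case 2
    then show ?case
      by (intro classes_2) blast+
  next
    case 3
    then show ?case
      by (intro classes_1) blast+
  next
    case 4
    then show ?case
      by (intro classes_5) blast+
  qed
qed

end
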